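(* $FBL[E]$ has the isometric lattice-lifting property for every Banach space $E$.
   Context: All Banach spaces are real; $B_E$ is the closed unit ball of $E$ and $E^*$ is its topological dual. A lattice homomorphism between Banach lattices is a bounded linear operator preserving lattice operations. A sublattice means a closed vector sublattice. Free Banach lattice: for a Banach space $E$ and a positively homogeneous function $f:E^*\to\mathbb{R}$ (i.e. $f(\lambda x^* )=\lambda f(x^* )$ for every $\lambda>0$ and every $x^*\in E^*$), put $\|f\|_{FBL[E]}:=\sup\{\sum_{i=1}^n|f(x_i^* )|: n\in\mathbb{N},\ x_1^*,\dots,x_n^*\in E^*,\ \sup_{x\in B_E}\sum_{i=1}^n|x_i^*(x)|\le 1\}\in[0,\infty]$. Let $H_0[E]$ be the Banach lattice of all positively homogeneous functions $f:E^*\to\mathbb{R}$ with $\|f\|_{FBL[E]}<\infty$, equipped with this norm and the pointwise order. $FBL[E]$ is the (closed) sublattice of $H_0[E]$ generated by $\{\delta_E(x):x\in E\}$, where $\delta_E(x):E^*\to\mathbb{R}$ is given by $\delta_E(x)(x^* ):=x^*(x)$. The map $\delta_E:E\to FBL[E]$ is a linear isometry, and for every Banach lattice $X$ and every bounded linear operator $T:E\to X$ there is a unique lattice homomorphism $\hat T:FBL[E]\to X$ with $\hat T\circ\delta_E=T$; moreover $\|\hat T\|=\|T\|$. For a Banach lattice $X$, $\beta_X:FBL[X]\to X$ denotes the unique lattice homomorphism with $\beta_X\circ\delta_X=id_X$, where $id_X$ is the identity map on $X$. A Banach lattice $X$ has the lattice-lifting property if there exists a lattice homomorphism $T:X\to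 FBL[X]$ such that $\beta_X\circ T=id_X$. If in addition $T$ can be chosen with $\|T\|=1$, then $X$ has the isometric lattice-lifting property. *)

theory Defs
  imports "HOL-Analysis.Analysis"
begin

section \<open>Banach lattices\<close>

text \<open>The modulus of \<open>x\<close> is \<open>sup x (- x)\<close>.\<close>

class banach_lattice = banach + ordered_real_vector + lattice +
  assumes norm_mono_modulus: "sup x (- x) \<le> sup y (- y) \<Longrightarrow> norm x \<le> norm y"

definition lattice_hom :: "('a::banach_lattice \<Rightarrow> 'b::banach_lattice) \<Rightarrow> bool" where
  "lattice_hom T \<longleftrightarrow> bounded_linear T \<and>
     (\<forall>x y. T (sup x y) = sup (T x) (T y)) \<and> (\<forall>x y. T (inf x y) = inf (T x) (T y))"

definition closed_sublattice :: "'a::banach_lattice set \<Rightarrow> bool" where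
  "closed_sublattice S \<longleftrightarrow> closed S \<and> subspace S \<and>
     (\<forall>x\<in>S. \<forall>y\<in>S. sup x y \<in> S) \<and> (\<forall>x\<in>S. \<forall>y\<in>S. inf x y \<in> S)"


section \<open>The Banach lattice \<open>H\<^sub>0[E]\<close>\<close>

text \<open>The dual of \<open>E = 'a\<close> is the type \<open>'a \<Rightarrow>\<^sub>L real\<close>.\<close>

definition pos_homogeneous :: "(('a::banach \<Rightarrow>\<^sub>L real) \<Rightarrow> real) \<Rightarrow> bool" where
  "pos_homogeneous f \<longleftrightarrow> (\<forall>c>0. \<forall>\<phi>. f (c *\<^sub>R \<phi>) = c * f \<phi>)"

text \<open>The finite families of functionals over which the norm of \<open>FBL[E]\<close> is a supremum. The inner
  real-valued supremum is over a bounded set (see \<open>admissible_iff\<close>). The empty family is included;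
  it contributes the value 0.\<close>

definition admissible :: "('a::banach \<Rightarrow>\<^sub>L real) list set" where
  "admissible = {\<phi>s. (SUP x\<in>cball 0 1. \<Sum>\<phi>\<leftarrow>\<phi>s. \<bar>blinfun_apply \<phi> x\<bar>) \<le> 1}"

definition fbl_norm :: "(('a::banach \<Rightarrow>\<^sub>L real) \<Rightarrow> real) \<Rightarrow> ennreal" where
  "fbl_norm f = (SUP \<phi>s\<in>admissible. ennreal (\<Sum>\<phi>\<leftarrow>\<phi>s. \<bar>f \<phi>\<bar>))"

lemma admissible_iff:
  fixes \<phi>s :: "('a::banach \<Rightarrow>\<^sub>L real) list"
  shows "\<phi>s \<in> admissible \<longleftrightarrow> (\<forall>x. norm x \<le> 1 \<longrightarrow> (\<Sum>\<phi>\<leftarrow>\<phi>s. \<bar>blinfun_apply \<phi> x\<bar>) \<le> 1)"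
proof -
  have "(\<Sum>\<phi>\<leftarrow>\<phi>s. \<bar>blinfun_apply \<phi> x\<bar>) \<le> (\<Sum>\<phi>\<leftarrow>\<phi>s. norm \<phi>)" if "norm x \<le> 1" for x
  proof (rule sum_list_mono)
    fix \<phi> :: "'a \<Rightarrow>\<^sub>L real"
    have "\<bar>blinfun_apply \<phi> x\<bar> \<le> norm \<phi> * norm x"
      using norm_blinfun[of \<phi> x] by simp
    also have "\<dots> \<le> norm \<phi>"
      using that by (simp add: mult_left_le)
    finally show "\<bar>blinfun_apply \<phi> x\<bar> \<le> norm \<phi>" .
  qed
  then have "bdd_above ((\<lambda>x. \<Sum>\<phi>\<leftarrow>\<phi>s. \<bar>blinfun_apply \<phi> x\<bar>) ` cball 0 1)"
    by (intro bdd_aboveI2[where M = "\<Sum>\<phi>\<leftarrow>\<phi>s. norm \<phi>"]) auto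
  moreover have "cball (0::'a) 1 \<noteq> {}"
    by simp
  ultimately show ?thesis
    by (simp add: admissible_def cSUP_le_iff Ball_def del: cball_eq_empty)
qed

lemma admissible_Nil: "[] \<in> admissible"
  by (simp add: admissible_iff)

lemma admissible_single:
  assumes "norm \<phi> \<le> 1"
  shows "[\<phi>] \<in> admissible"
  unfolding admissible_iff
proof (intro allI impI)
  fix x :: 'a
  assume x: "norm x \<le> 1"
  have "\<bar>blinfun_apply \<phi> x\<bar> \<le> norm \<phi> * norm x"
    using norm_blinfun[of \<phi> x] by simp
  also have "\<dots> \<le> 1"
    using assms x by (simp add: mult_le_one)
  finally show "(\<Sum>\<phi>\<leftarrow>[\<phi>]. \<bar>blinfun_apply \<phi> x\<bar>) \<le> 1"
    by simp
qed

lemma fbl_norm_le_iff: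
  assumes "0 \<le> B"
  shows "fbl_norm f \<le> ennreal B \<longleftrightarrow> (\<forall>\<phi>s\<in>admissible. (\<Sum>\<phi>\<leftarrow>\<phi>s. \<bar>f \<phi>\<bar>) \<le> B)"
  using assms by (simp add: fbl_norm_def SUP_le_iff)

lemma fbl_norm_finiteI:
  assumes "0 \<le> B" and "\<And>\<phi>s. \<phi>s \<in> admissible \<Longrightarrow> (\<Sum>\<phi>\<leftarrow>\<phi>s. \<bar>f \<phi>\<bar>) \<le> B"
  shows "fbl_norm f < \<infinity>"
proof -
  have "fbl_norm f \<le> ennreal B"
    using assms by (simp add: fbl_norm_le_iff)
  then show ?thesis
    by (metis ennreal_less_top infinity_ennreal_def le_less_trans)
qed

lemma sum_list_le_fbl_norm:
  assumes "fbl_norm f < \<infinity>" and "\<phi>s \<in> admissible"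
  shows "(\<Sum>\<phi>\<leftarrow>\<phi>s. \<bar>f \<phi>\<bar>) \<le> enn2real (fbl_norm f)"
proof -
  have "fbl_norm f \<le> ennreal (enn2real (fbl_norm f))"
    using assms(1) by (simp add: ennreal_enn2real_if)
  then show ?thesis
    using fbl_norm_le_iff[OF enn2real_nonneg] assms(2) by blast
qed

typedef (overloaded) ('a::banach) h0 =
  "{f :: ('a \<Rightarrow>\<^sub>L real) \<Rightarrow> real. pos_homogeneous f \<and> fbl_norm f < \<infinity>}"
  morphisms h0_apply Abs_h0
proof
  show "(\<lambda>_. 0) \<in> {f :: ('a \<Rightarrow>\<^sub>L real) \<Rightarrow> real. pos_homogeneous f \<and> fbl_norm f < \<infinity>}"
    using fbl_norm_finiteI[of 0 "\<lambda>_. 0"] by (simp add: pos_homogeneous_def)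
qed

setup_lifting type_definition_h0

lemma fbl_norm_dominated:
  assumes "fbl_norm f < \<infinity>" "fbl_norm g < \<infinity>" "0 \<le> a"
    and "\<And>\<phi>. \<bar>h \<phi>\<bar> \<le> a * \<bar>f \<phi>\<bar> + \<bar>g \<phi>\<bar>"
  shows "fbl_norm h < \<infinity>"
proof (rule fbl_norm_finiteI)
  show "0 \<le> a * enn2real (fbl_norm f) + enn2real (fbl_norm g)"
    using assms(3) by simp
  fix \<phi>s :: "('a \<Rightarrow>\<^sub>L real) list"
  assume adm: "\<phi>s \<in> admissible"
  have "(\<Sum>\<phi>\<leftarrow>\<phi>s. \<bar>h \<phi>\<bar>) \<le> (\<Sum>\<phi>\<leftarrow>\<phi>s. a * \<bar>f \<phi>\<bar> + \<bar>g \<phi>\<bar>)"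
    by (rule sum_list_mono) (rule assms(4))
  also have "\<dots> = a * (\<Sum>\<phi>\<leftarrow>\<phi>s. \<bar>f \<phi>\<bar>) + (\<Sum>\<phi>\<leftarrow>\<phi>s. \<bar>g \<phi>\<bar>)"
    by (simp add: sum_list_addf sum_list_const_mult)
  also have "\<dots> \<le> a * enn2real (fbl_norm f) + enn2real (fbl_norm g)"
    using assms(3) sum_list_le_fbl_norm[OF assms(1) adm] sum_list_le_fbl_norm[OF assms(2) adm]
    by (intro add_mono mult_left_mono)
  finally show "(\<Sum>\<phi>\<leftarrow>\<phi>s. \<bar>h \<phi>\<bar>) \<le> a * enn2real (fbl_norm f) + enn2real (fbl_norm g)" .
qed

lemma fbl_norm_dominated_add:
  assumes "fbl_norm f < \<infinity>" "fbl_norm g < \<infinity>" and "\<And>\<phi>. \<bar>h \<phi>\<bar> \<le> \<bar>f \<phi>\<bar> + \<bar>g \<phi>\<bar>"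
  shows "fbl_norm h < \<infinity>"
  using fbl_norm_dominated[of f g 1 h] assms by simp

lemma pos_homogeneous_max:
  assumes "pos_homogeneous f" "pos_homogeneous g"
  shows "pos_homogeneous (\<lambda>\<phi>. max (f \<phi>) (g \<phi>))" "pos_homogeneous (\<lambda>\<phi>. min (f \<phi>) (g \<phi>))"
  using assms by (simp_all add: pos_homogeneous_def max_mult_distrib_left min_mult_distrib_left)

instantiation h0 :: (banach) "{real_vector, ordered_ab_group_add, lattice}"
begin

lift_definition zero_h0 :: "'a h0" is "\<lambda>_. 0"
  using fbl_norm_finiteI[of 0 "\<lambda>_. 0"] by (simp add: pos_homogeneous_def)

lift_definition plus_h0 :: "'a h0 \<Rightarrow> 'a h0 \<Rightarrow> 'a h0" is "\<lambda>f g \<phi>. f \<phi> + g \<phi>"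
  by (auto simp: pos_homogeneous_def distrib_left simp del: infinity_ennreal_def
      intro: fbl_norm_dominated_add)

lift_definition minus_h0 :: "'a h0 \<Rightarrow> 'a h0 \<Rightarrow> 'a h0" is "\<lambda>f g \<phi>. f \<phi> - g \<phi>"
  by (auto simp: pos_homogeneous_def right_diff_distrib simp del: infinity_ennreal_def
      intro: fbl_norm_dominated_add)

lift_definition uminus_h0 :: "'a h0 \<Rightarrow> 'a h0" is "\<lambda>f \<phi>. - f \<phi>"
  by (auto simp: pos_homogeneous_def simp del: infinity_ennreal_def
      intro: fbl_norm_dominated_add)

lift_definition scaleR_h0 :: "real \<Rightarrow> 'a h0 \<Rightarrow> 'a h0" is "\<lambda>r f \<phi>. r * f \<phi>"
  subgoal for r f
    using fbl_norm_dominated[of f f "\<bar>r\<bar>" "\<lambda>\<phi>. r * f \<phi>"]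
    by (auto simp: pos_homogeneous_def abs_mult)
  done

lift_definition sup_h0 :: "'a h0 \<Rightarrow> 'a h0 \<Rightarrow> 'a h0" is "\<lambda>f g \<phi>. max (f \<phi>) (g \<phi>)"
  by (auto simp: pos_homogeneous_max simp del: infinity_ennreal_def
      intro: fbl_norm_dominated_add)

lift_definition inf_h0 :: "'a h0 \<Rightarrow> 'a h0 \<Rightarrow> 'a h0" is "\<lambda>f g \<phi>. min (f \<phi>) (g \<phi>)"
  by (auto simp: pos_homogeneous_max simp del: infinity_ennreal_def
      intro: fbl_norm_dominated_add)

lift_definition less_eq_h0 :: "'a h0 \<Rightarrow> 'a h0 \<Rightarrow> bool" is "\<lambda>f g. \<forall>\<phi>. f \<phi> \<le> g \<phi>" .

definition less_h0 :: "'a h0 \<Rightarrow> 'a h0 \<Rightarrow> bool" where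
  "less_h0 f g \<longleftrightarrow> f \<le> g \<and> \<not> g \<le> f"

instance
proof
  fix f g h :: "'a h0" and a b :: real
  show "f + g + h = f + (g + h)" by transfer (simp add: algebra_simps)
  show "f + g = g + f" by transfer (simp add: algebra_simps)
  show "0 + f = f" by transfer simp
  show "- f + f = 0" by transfer simp
  show "f - g = f + - g" by transfer simp
  show "a *\<^sub>R (f + g) = a *\<^sub>R f + a *\<^sub>R g" by transfer (simp add: algebra_simps)
  show "(a + b) *\<^sub>R f = a *\<^sub>R f + b *\<^sub>R f" by transfer (simp add: algebra_simps)
  show "a *\<^sub>R b *\<^sub>R f = (a * b) *\<^sub>R f" by transfer (simp add: algebra_simps)
  show "1 *\<^sub>R f = f" by transfer simp
  show "f < g \<longleftrightarrow> f \<le> g \<and> \<not> g \<le> f" by (rule less_h0_def)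
  show "f \<le> f" by transfer simp
  show "f \<le> g \<Longrightarrow> g \<le> h \<Longrightarrow> f \<le> h" by transfer (meson order_trans)
  show "f \<le> g \<Longrightarrow> g \<le> f \<Longrightarrow> f = g" by transfer (simp add: fun_eq_iff order_antisym)
  show "f \<le> g \<Longrightarrow> h + f \<le> h + g" by transfer simp
  show "inf f g \<le> f" by transfer simp
  show "inf f g \<le> g" by transfer simp
  show "f \<le> g \<Longrightarrow> f \<le> h \<Longrightarrow> f \<le> inf g h" by transfer simp
  show "f \<le> sup f g" by transfer simp
  show "g \<le> sup f g" by transfer simp
  show "g \<le> f \<Longrightarrow> h \<le> f \<Longrightarrow> sup g h \<le> f" by transfer simp
qed

end

instance h0 :: (banach) ordered_real_vector
proof
  fix f g :: "'a h0" and a b :: real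
  show "f \<le> g \<Longrightarrow> 0 \<le> a \<Longrightarrow> a *\<^sub>R f \<le> a *\<^sub>R g"
    by transfer (simp add: mult_left_mono)
  show "a \<le> b \<Longrightarrow> 0 \<le> f \<Longrightarrow> a *\<^sub>R f \<le> b *\<^sub>R f"
    by transfer (simp add: mult_right_mono)
qed

instantiation h0 :: (banach) real_normed_vector
begin

lift_definition norm_h0 :: "'a h0 \<Rightarrow> real" is "\<lambda>f. enn2real (fbl_norm f)" .

definition sgn_h0 :: "'a h0 \<Rightarrow> 'a h0" where
  "sgn_h0 f = inverse (norm f) *\<^sub>R f"

definition dist_h0 :: "'a h0 \<Rightarrow> 'a h0 \<Rightarrow> real" where
  "dist_h0 f g = norm (f - g)"

definition uniformity_h0 :: "('a h0 \<times> 'a h0) filter" where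
  "uniformity_h0 = (INF e\<in>{0 <..}. principal {(f, g). dist f g < e})"

definition open_h0 :: "'a h0 set \<Rightarrow> bool" where
  "open_h0 U \<longleftrightarrow> (\<forall>f\<in>U. eventually (\<lambda>(f', g). f' = f \<longrightarrow> g \<in> U) uniformity)"

lemma sum_list_le_norm_h0:
  "\<phi>s \<in> admissible \<Longrightarrow> (\<Sum>\<phi>\<leftarrow>\<phi>s. \<bar>h0_apply f \<phi>\<bar>) \<le> norm f"
  by transfer (simp add: sum_list_le_fbl_norm)

lemma norm_h0_leI:
  assumes "0 \<le> B" and "\<And>\<phi>s. \<phi>s \<in> admissible \<Longrightarrow> (\<Sum>\<phi>\<leftarrow>\<phi>s. \<bar>h0_apply f \<phi>\<bar>) \<le> B"
  shows "norm f \<le> B"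
  using assms by transfer (simp add: fbl_norm_le_iff enn2real_leI)

lemma norm_h0_nonneg: "0 \<le> norm (f :: 'a::banach h0)"
  by transfer simp

lemma h0_apply_scaleR: "c > 0 \<Longrightarrow> h0_apply f (c *\<^sub>R \<phi>) = c * h0_apply f \<phi>"
  using h0_apply[of f] by (simp add: pos_homogeneous_def)

lemma h0_apply_0: "h0_apply f 0 = 0"
  using h0_apply_scaleR[of 2 f 0] by simp

lemma abs_h0_apply_le: "\<bar>h0_apply f \<phi>\<bar> \<le> norm f * norm \<phi>"
proof (cases "\<phi> = 0")
  case True
  then show ?thesis by (simp add: h0_apply_0)
next
  case False
  have "\<bar>h0_apply f (inverse (norm \<phi>) *\<^sub>R \<phi>)\<bar> \<le> norm f"
    using sum_list_le_norm_h0[OF admissible_single, of "inverse (norm \<phi>) *\<^sub>R \<phi>" f] False by simp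
  then show ?thesis
    using False by (simp add: h0_apply_scaleR abs_mult field_simps)
qed

instance
proof
  fix f g :: "'a h0" and a :: real
  show "dist f g = norm (f - g)" by (rule dist_h0_def)
  show "sgn f = f /\<^sub>R norm f" by (rule sgn_h0_def)
  show "uniformity = (INF e\<in>{0 <..}. principal {(x::'a h0, y). dist x y < e})"
    by (rule uniformity_h0_def)
  show "open U \<longleftrightarrow> (\<forall>x\<in>U. \<forall>\<^sub>F (x', y) in uniformity. x' = x \<longrightarrow> y \<in> U)" for U :: "'a h0 set"
    by (rule open_h0_def)
  show "norm f = 0 \<longleftrightarrow> f = 0"
  proof
    assume "norm f = 0"
    then have "h0_apply f \<phi> = 0" for \<phi>
      using abs_h0_apply_le[of f \<phi>] by simp
    then show "f = 0"
      by transfer (simp add: fun_eq_iff)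
  next
    assume "f = 0"
    then have "norm f \<le> 0"
      by (intro norm_h0_leI) (simp_all add: zero_h0.rep_eq)
    then show "norm f = 0"
      using norm_h0_nonneg[of f] by simp
  qed
  show "norm (f + g) \<le> norm f + norm g"
  proof (rule norm_h0_leI)
    show "0 \<le> norm f + norm g" by (simp add: norm_h0_nonneg)
    fix \<phi>s :: "('a \<Rightarrow>\<^sub>L real) list"
    assume adm: "\<phi>s \<in> admissible"
    have "(\<Sum>\<phi>\<leftarrow>\<phi>s. \<bar>h0_apply (f + g) \<phi>\<bar>) \<le> (\<Sum>\<phi>\<leftarrow>\<phi>s. \<bar>h0_apply f \<phi>\<bar> + \<bar>h0_apply g \<phi>\<bar>)"
      by (rule sum_list_mono) (simp add: plus_h0.rep_eq)
    also have "\<dots> \<le> norm f + norm g"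
      using sum_list_le_norm_h0[OF adm, of f] sum_list_le_norm_h0[OF adm, of g]
      by (simp add: sum_list_addf)
    finally show "(\<Sum>\<phi>\<leftarrow>\<phi>s. \<bar>h0_apply (f + g) \<phi>\<bar>) \<le> norm f + norm g" .
  qed
  have le: "norm (c *\<^sub>R h) \<le> \<bar>c\<bar> * norm h" for c and h :: "'a h0"
  proof (rule norm_h0_leI)
    show "0 \<le> \<bar>c\<bar> * norm h" by (simp add: norm_h0_nonneg)
    show "(\<Sum>\<phi>\<leftarrow>\<phi>s. \<bar>h0_apply (c *\<^sub>R h) \<phi>\<bar>) \<le> \<bar>c\<bar> * norm h" if "\<phi>s \<in> admissible" for \<phi>s
      using sum_list_le_norm_h0[OF that, of h]
      by (simp add: scaleR_h0.rep_eq abs_mult sum_list_const_mult mult_left_mono)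
  qed
  show "norm (a *\<^sub>R f) = \<bar>a\<bar> * norm f"
  proof (cases "a = 0")
    case True
    then show ?thesis
      using le[of a f] norm_h0_nonneg[of "a *\<^sub>R f"] by simp
  next
    case False
    then have "norm f \<le> \<bar>inverse a\<bar> * norm (a *\<^sub>R f)"
      using le[of "inverse a" "a *\<^sub>R f"] by simp
    then have "\<bar>a\<bar> * norm f \<le> norm (a *\<^sub>R f)"
      using False by (simp add: field_simps)
    then show ?thesis
      using le[of a f] by simp
  qed
qed

end

instance h0 :: (banach) banach_lattice
proof
  fix f g :: "'a h0"
  assume "sup f (- f) \<le> sup g (- g)"
  then have "max (h0_apply f \<phi>) (- h0_apply f \<phi>) \<le> max (h0_apply g \<phi>) (- h0_apply g \<phi>)" for \<phi>
    by (simp only: less_eq_h0.rep_eq sup_h0.rep_eq uminus_h0.rep_eq)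
  moreover have abs_real_max: "\<bar>a\<bar> = max a (- a)" for a :: real
    by simp
  ultimately have *: "\<bar>h0_apply f \<phi>\<bar> \<le> \<bar>h0_apply g \<phi>\<bar>" for \<phi>
    by (metis abs_real_max)
  show "norm f \<le> norm g"
  proof (rule norm_h0_leI)
    show "(\<Sum>\<phi>\<leftarrow>\<phi>s. \<bar>h0_apply f \<phi>\<bar>) \<le> norm g" if "\<phi>s \<in> admissible" for \<phi>s
      using sum_list_le_norm_h0[OF that, of g] sum_list_mono[of \<phi>s, OF *] by (meson order_trans)
  qed simp
next
  fix X :: "nat \<Rightarrow> 'a h0"
  assume X: "Cauchy X"
  have "Cauchy (\<lambda>n. h0_apply (X n) \<phi>)" for \<phi>
  proof (rule metric_CauchyI)
    fix e :: real
    assume "0 < e"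
    then have "0 < e / (norm \<phi> + 1)"
      by (simp add: add_nonneg_pos)
    then obtain N where N: "\<And>m n. m \<ge> N \<Longrightarrow> n \<ge> N \<Longrightarrow> norm (X m - X n) < e / (norm \<phi> + 1)"
      using CauchyD[OF X, of "e / (norm \<phi> + 1)"] by auto
    have "dist (h0_apply (X m) \<phi>) (h0_apply (X n) \<phi>) < e" if "m \<ge> N" "n \<ge> N" for m n
    proof -
      have "dist (h0_apply (X m) \<phi>) (h0_apply (X n) \<phi>) \<le> norm (X m - X n) * norm \<phi>"
        using abs_h0_apply_le[of "X m - X n" \<phi>] by (simp add: dist_real_def minus_h0.rep_eq)
      also have "\<dots> \<le> norm (X m - X n) * (norm \<phi> + 1)"
        by (simp add: mult_left_mono)
      also have "\<dots> < e"
        using N[OF that] by (simp add: pos_less_divide_eq add_nonneg_pos)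
      finally show ?thesis .
    qed
    then show "\<exists>N. \<forall>m\<ge>N. \<forall>n\<ge>N. dist (h0_apply (X m) \<phi>) (h0_apply (X n) \<phi>) < e"
      by blast
  qed
  then have "\<exists>l. (\<lambda>n. h0_apply (X n) \<phi>) \<longlonglongrightarrow> l" for \<phi>
    by (intro convergentD Cauchy_convergent)
  then obtain F where F: "\<And>\<phi>. (\<lambda>n. h0_apply (X n) \<phi>) \<longlonglongrightarrow> F \<phi>"
    by metis
  have sum_lim: "(\<lambda>n. \<Sum>\<phi>\<leftarrow>\<phi>s. \<bar>h0_apply (X m) \<phi> - h0_apply (X n) \<phi>\<bar>)
      \<longlonglongrightarrow> (\<Sum>\<phi>\<leftarrow>\<phi>s. \<bar>h0_apply (X m) \<phi> - F \<phi>\<bar>)" for m \<phi>s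
    by (induction \<phi>s) (auto intro!: tendsto_intros F)
  have close: "(\<Sum>\<phi>\<leftarrow>\<phi>s. \<bar>h0_apply (X m) \<phi> - F \<phi>\<bar>) \<le> e"
    if "\<And>n. n \<ge> N \<Longrightarrow> norm (X m - X n) < e" "\<phi>s \<in> admissible" for m N e \<phi>s
  proof (rule LIMSEQ_le_const2[OF sum_lim])
    have "(\<Sum>\<phi>\<leftarrow>\<phi>s. \<bar>h0_apply (X m) \<phi> - h0_apply (X n) \<phi>\<bar>) \<le> e" if "n \<ge> N" for n
      using sum_list_le_norm_h0[OF \<open>\<phi>s \<in> admissible\<close>, of "X m - X n"]
        \<open>\<And>n. n \<ge> N \<Longrightarrow> norm (X m - X n) < e\<close>[OF that]
      by (simp add: minus_h0.rep_eq)
    then show "\<exists>N. \<forall>n\<ge>N. (\<Sum>\<phi>\<leftarrow>\<phi>s. \<bar>h0_apply (X m) \<phi> - h0_apply (X n) \<phi>\<bar>) \<le> e"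
      by blast
  qed
  have hom: "pos_homogeneous F"
    unfolding pos_homogeneous_def
  proof (intro allI impI)
    fix c :: real and \<phi> :: "'a \<Rightarrow>\<^sub>L real"
    assume "0 < c"
    then have "(\<lambda>n. h0_apply (X n) (c *\<^sub>R \<phi>)) \<longlonglongrightarrow> c * F \<phi>"
      by (simp add: h0_apply_scaleR) (intro tendsto_intros F)
    then show "F (c *\<^sub>R \<phi>) = c * F \<phi>"
      using F LIMSEQ_unique by blast
  qed
  obtain N where N: "\<And>m n. m \<ge> N \<Longrightarrow> n \<ge> N \<Longrightarrow> norm (X m - X n) < 1"
    using CauchyD[OF X, of 1] by auto
  have "fbl_norm F < \<infinity>"
  proof (rule fbl_norm_finiteI)
    show "0 \<le> norm (X N) + 1" by simp
    fix \<phi>s :: "('a \<Rightarrow>\<^sub>L real) list"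
    assume adm: "\<phi>s \<in> admissible"
    have "(\<Sum>\<phi>\<leftarrow>\<phi>s. \<bar>F \<phi>\<bar>)
        \<le> (\<Sum>\<phi>\<leftarrow>\<phi>s. \<bar>h0_apply (X N) \<phi>\<bar> + \<bar>h0_apply (X N) \<phi> - F \<phi>\<bar>)"
      by (rule sum_list_mono) simp
    also have "\<dots> \<le> norm (X N) + 1"
      using sum_list_le_norm_h0[OF adm, of "X N"] close[of N N 1, OF N[OF order_refl] adm]
      by (simp add: sum_list_addf)
    finally show "(\<Sum>\<phi>\<leftarrow>\<phi>s. \<bar>F \<phi>\<bar>) \<le> norm (X N) + 1" .
  qed
  then have apply_F: "h0_apply (Abs_h0 F) = F"
    using hom by (simp add: Abs_h0_inverse)
  have "X \<longlonglongrightarrow> Abs_h0 F"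
  proof (rule LIMSEQ_I)
    fix e :: real
    assume "0 < e"
    then obtain M where M: "\<And>m n. m \<ge> M \<Longrightarrow> n \<ge> M \<Longrightarrow> norm (X m - X n) < e / 2"
      using CauchyD[OF X, of "e / 2"] by auto
    have "norm (X m - Abs_h0 F) < e" if "m \<ge> M" for m
    proof -
      have "norm (X m - Abs_h0 F) \<le> e / 2"
        using close[OF M[OF that]] \<open>0 < e\<close>
        by (intro norm_h0_leI) (simp_all add: minus_h0.rep_eq apply_F)
      then show ?thesis
        using \<open>0 < e\<close> by simp
    qed
    then show "\<exists>M. \<forall>m\<ge>M. norm (X m - Abs_h0 F) < e"
      by blast
  qed
  then show "convergent X"
    by (rule convergentI)
qed


section \<open>The free Banach lattice\<close>

lift_definition eval_h0 :: "'a::banach \<Rightarrow> 'a h0" is "\<lambda>x \<phi>. blinfun_apply \<phi> x"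
proof -
  fix x :: 'a
  have "(\<Sum>\<phi>\<leftarrow>\<phi>s. \<bar>blinfun_apply \<phi> x\<bar>) \<le> norm x" if adm: "\<phi>s \<in> admissible" for \<phi>s
  proof (cases "x = 0")
    case False
    have "(\<Sum>\<phi>\<leftarrow>\<phi>s. \<bar>blinfun_apply \<phi> (inverse (norm x) *\<^sub>R x)\<bar>) \<le> 1"
      using adm False by (simp add: admissible_iff)
    then have "inverse (norm x) * (\<Sum>\<phi>\<leftarrow>\<phi>s. \<bar>blinfun_apply \<phi> x\<bar>) \<le> 1"
      by (simp add: blinfun.scaleR_right abs_mult sum_list_const_mult del: inverse_eq_divide)
    then show ?thesis
      using False by (simp add: field_simps)
  qed (simp add: blinfun.zero_right)
  then have "fbl_norm (\<lambda>\<phi>. blinfun_apply \<phi> x) < \<infinity>"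
    by (intro fbl_norm_finiteI[of "norm x"]) simp_all
  then show "pos_homogeneous (\<lambda>\<phi>. blinfun_apply \<phi> x) \<and> fbl_norm (\<lambda>\<phi>. blinfun_apply \<phi> x) < \<infinity>"
    by (simp add: pos_homogeneous_def blinfun.scaleR_left)
qed

text \<open>The \<open>hull\<close> is the intersection of all closed sublattices of \<open>H\<^sub>0[E]\<close> containing the
  evaluations.\<close>

definition fbl_set :: "'a::banach h0 set" where
  "fbl_set = closed_sublattice hull (range eval_h0)"

lemma closed_sublattice_fbl_set: "closed_sublattice (fbl_set :: 'a::banach h0 set)"
  unfolding fbl_set_def
  by (rule hull_in) (auto simp: closed_sublattice_def subspace_def)

lemma closed_fbl_set: "closed (fbl_set :: 'a::banach h0 set)"
  and subspace_fbl_set: "subspace (fbl_set :: 'a h0 set)"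
  and sup_fbl_set: "f \<in> fbl_set \<Longrightarrow> g \<in> fbl_set \<Longrightarrow> sup f g \<in> (fbl_set :: 'a h0 set)"
  and inf_fbl_set: "f \<in> fbl_set \<Longrightarrow> g \<in> fbl_set \<Longrightarrow> inf f g \<in> (fbl_set :: 'a h0 set)"
  using closed_sublattice_fbl_set[where 'a='a] by (simp_all add: closed_sublattice_def)

lemma eval_h0_in_fbl_set: "eval_h0 x \<in> fbl_set"
  unfolding fbl_set_def by (rule hull_inc) simp

typedef (overloaded) ('a::banach) fbl = "fbl_set :: 'a h0 set"
  morphisms h0_of_fbl Abs_fbl
  using eval_h0_in_fbl_set by blast

setup_lifting type_definition_fbl

instantiation fbl :: (banach) "{real_vector, ordered_ab_group_add, lattice}"
begin

lift_definition zero_fbl :: "'a fbl" is 0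
  by (rule subspace_0[OF subspace_fbl_set])

lift_definition plus_fbl :: "'a fbl \<Rightarrow> 'a fbl \<Rightarrow> 'a fbl" is "(+)"
  by (rule subspace_add[OF subspace_fbl_set])

lift_definition minus_fbl :: "'a fbl \<Rightarrow> 'a fbl \<Rightarrow> 'a fbl" is "(-)"
  by (rule subspace_diff[OF subspace_fbl_set])

lift_definition uminus_fbl :: "'a fbl \<Rightarrow> 'a fbl" is uminus
  by (rule subspace_neg[OF subspace_fbl_set])

lift_definition scaleR_fbl :: "real \<Rightarrow> 'a fbl \<Rightarrow> 'a fbl" is scaleR
  by (rule subspace_scale[OF subspace_fbl_set])

lift_definition sup_fbl :: "'a fbl \<Rightarrow> 'a fbl \<Rightarrow> 'a fbl" is sup
  by (rule sup_fbl_set)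

lift_definition inf_fbl :: "'a fbl \<Rightarrow> 'a fbl \<Rightarrow> 'a fbl" is inf
  by (rule inf_fbl_set)

lift_definition less_eq_fbl :: "'a fbl \<Rightarrow> 'a fbl \<Rightarrow> bool" is "(\<le>)" .

lift_definition less_fbl :: "'a fbl \<Rightarrow> 'a fbl \<Rightarrow> bool" is "(<)" .

instance
proof
  fix f g h :: "'a fbl" and a b :: real
  show "f + g + h = f + (g + h)" by transfer (simp add: algebra_simps)
  show "f + g = g + f" by transfer (simp add: algebra_simps)
  show "0 + f = f" by transfer simp
  show "- f + f = 0" by transfer simp
  show "f - g = f + - g" by transfer simp
  show "a *\<^sub>R (f + g) = a *\<^sub>R f + a *\<^sub>R g" by transfer (simp add: algebra_simps)
  show "(a + b) *\<^sub>R f = a *\<^sub>R f + b *\<^sub>R f" by transfer (simp add: algebra_simps)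
  show "a *\<^sub>R b *\<^sub>R f = (a * b) *\<^sub>R f" by transfer simp
  show "1 *\<^sub>R f = f" by transfer simp
  show "f < g \<longleftrightarrow> f \<le> g \<and> \<not> g \<le> f" by transfer (simp add: less_le_not_le)
  show "f \<le> f" by transfer simp
  show "f \<le> g \<Longrightarrow> g \<le> h \<Longrightarrow> f \<le> h" by transfer simp
  show "f \<le> g \<Longrightarrow> g \<le> f \<Longrightarrow> f = g" by transfer simp
  show "f \<le> g \<Longrightarrow> h + f \<le> h + g" by transfer simp
  show "inf f g \<le> f" by transfer simp
  show "inf f g \<le> g" by transfer simp
  show "f \<le> g \<Longrightarrow> f \<le> h \<Longrightarrow> f \<le> inf g h" by transfer simp
  show "f \<le> sup f g" by transfer simp
  show "g \<le> sup f g" by transfer simp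
  show "g \<le> f \<Longrightarrow> h \<le> f \<Longrightarrow> sup g h \<le> f" by transfer simp
qed

end

instance fbl :: (banach) ordered_real_vector
proof
  fix f g :: "'a fbl" and a b :: real
  show "f \<le> g \<Longrightarrow> 0 \<le> a \<Longrightarrow> a *\<^sub>R f \<le> a *\<^sub>R g"
    by transfer (simp add: scaleR_left_mono)
  show "a \<le> b \<Longrightarrow> 0 \<le> f \<Longrightarrow> a *\<^sub>R f \<le> b *\<^sub>R f"
    by transfer (simp add: scaleR_right_mono)
qed

instantiation fbl :: (banach) real_normed_vector
begin

lift_definition norm_fbl :: "'a fbl \<Rightarrow> real" is norm .

definition sgn_fbl :: "'a fbl \<Rightarrow> 'a fbl" where
  "sgn_fbl f = inverse (norm f) *\<^sub>R f"

definition dist_fbl :: "'a fbl \<Rightarrow> 'a fbl \<Rightarrow> real" where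
  "dist_fbl f g = norm (f - g)"

definition uniformity_fbl :: "('a fbl \<times> 'a fbl) filter" where
  "uniformity_fbl = (INF e\<in>{0 <..}. principal {(f, g). dist f g < e})"

definition open_fbl :: "'a fbl set \<Rightarrow> bool" where
  "open_fbl U \<longleftrightarrow> (\<forall>f\<in>U. eventually (\<lambda>(f', g). f' = f \<longrightarrow> g \<in> U) uniformity)"

instance
proof
  fix f g :: "'a fbl" and a :: real
  show "dist f g = norm (f - g)" by (rule dist_fbl_def)
  show "sgn f = f /\<^sub>R norm f" by (rule sgn_fbl_def)
  show "uniformity = (INF e\<in>{0 <..}. principal {(x::'a fbl, y). dist x y < e})"
    by (rule uniformity_fbl_def)
  show "open U \<longleftrightarrow> (\<forall>x\<in>U. \<forall>\<^sub>F (x', y) in uniformity. x' = x \<longrightarrow> y \<in> U)" for U :: "'a fbl set"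
    by (rule open_fbl_def)
  show "norm f = 0 \<longleftrightarrow> f = 0" by transfer simp
  show "norm (f + g) \<le> norm f + norm g" by transfer (rule norm_triangle_ineq)
  show "norm (a *\<^sub>R f) = \<bar>a\<bar> * norm f" by transfer simp
qed

end

instance fbl :: (banach) banach_lattice
proof
  fix f g :: "'a fbl"
  show "sup f (- f) \<le> sup g (- g) \<Longrightarrow> norm f \<le> norm g"
    by transfer (rule norm_mono_modulus)
next
  fix X :: "nat \<Rightarrow> 'a fbl"
  assume X: "Cauchy X"
  have dist_eq: "dist (h0_of_fbl f) (h0_of_fbl g) = dist f g" for f g :: "'a fbl"
    by (simp add: dist_norm norm_fbl.rep_eq minus_fbl.rep_eq)
  have "Cauchy (\<lambda>n. h0_of_fbl (X n))"
    using X by (simp add: Cauchy_def dist_eq)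
  then obtain l where l: "(\<lambda>n. h0_of_fbl (X n)) \<longlonglongrightarrow> l"
    using Cauchy_convergent convergentD by blast
  have "l \<in> fbl_set"
    by (rule closed_sequentially[OF closed_fbl_set]) (use l h0_of_fbl in auto)
  then have "h0_of_fbl (Abs_fbl l) = l"
    by (rule Abs_fbl_inverse)
  then have "X \<longlonglongrightarrow> Abs_fbl l"
    using l by (simp add: tendsto_dist_iff[of X] tendsto_dist_iff[of "\<lambda>n. h0_of_fbl (X n)"]
        flip: dist_eq)
  then show "convergent X"
    by (rule convergentI)
qed

lift_definition delta :: "'a::banach \<Rightarrow> 'a fbl" is eval_h0
  by (rule eval_h0_in_fbl_set)


section \<open>Lattice-lifting properties\<close>

text \<open>By the universal property of \<open>FBL[X]\<close> there is exactly one such \<open>S\<close>.\<close>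

definition beta :: "'a::banach_lattice fbl \<Rightarrow> 'a" where
  "beta = (THE S. lattice_hom S \<and> S \<circ> delta = id)"

definition lattice_lifting_property :: "'a::banach_lattice itself \<Rightarrow> bool" where
  "lattice_lifting_property _ \<longleftrightarrow>
     (\<exists>T :: 'a \<Rightarrow> 'a fbl. lattice_hom T \<and> beta \<circ> T = id)"

definition isometric_lattice_lifting_property :: "'a::banach_lattice itself \<Rightarrow> bool" where
  "isometric_lattice_lifting_property _ \<longleftrightarrow>
     (\<exists>T :: 'a \<Rightarrow> 'a fbl. lattice_hom T \<and> beta \<circ> T = id \<and> onorm T = 1)"

end

theory Submission
  imports Defs
begin

text \<open>A positively homogeneous map \<open>\<iota>\<close> between duals that preserves admissible families induces, by
  \<open>f \<mapsto> f \<circ> \<iota>\<close>, a contractive lattice homomorphism between free Banach lattices. Applied to the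
  point evaluations \<open>E\<^sup>* \<rightarrow> FBL[E]\<^sup>*\<close> this gives \<open>\<beta>\<close>; applied to the adjoint of
  \<open>\<delta>\<^sub>E\<close> it gives a lifting \<open>T\<close>. Since \<open>\<beta> \<circ> T\<close> fixes the generators, it is the identity, and as both
  maps are contractive, \<open>T\<close> is an isometry. The Hahn--Banach theorem is needed only to see that
  \<open>FBL[E] \<noteq> 0\<close>.\<close>

section \<open>Hahn--Banach for sublinear functionals\<close>

definition sublinear :: "('a::real_vector \<Rightarrow> real) \<Rightarrow> bool" where
  "sublinear p \<longleftrightarrow> (\<forall>x y. p (x + y) \<le> p x + p y) \<and> (\<forall>c\<ge>0. \<forall>x. p (c *\<^sub>R x) = c * p x)"

lemma sublinear_add: "sublinear p \<Longrightarrow> p (x + y) \<le> p x + p y"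
  and sublinear_scaleR: "sublinear p \<Longrightarrow> 0 \<le> c \<Longrightarrow> p (c *\<^sub>R x) = c * p x"
  by (auto simp: sublinear_def)

lemma sublinear_0: "sublinear p \<Longrightarrow> p 0 = 0"
  using sublinear_scaleR[of p 0 0] by simp

lemma sublinear_minus_le: "sublinear p \<Longrightarrow> - p (- x) \<le> p x"
  using sublinear_add[of p x "- x"] sublinear_0[of p] by simp

text \<open>Applying the scaling inequality to \<open>inverse c\<close> and
  \<open>c *\<^sub>R x\<close> yields the reverse one, so an inequality is enough.\<close>

lemma sublinearI:
  assumes add: "\<And>x y. p (x + y) \<le> p x + p y"
    and scale: "\<And>c x. 0 < c \<Longrightarrow> p (c *\<^sub>R x) \<le> c * p x"
    and zero: "p 0 = 0"
  shows "sublinear p"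
proof -
  have "p (c *\<^sub>R x) = c * p x" if "c \<ge> 0" for c x
  proof (cases "c = 0")
    case False
    with that have c: "c > 0" by simp
    have "p x \<le> inverse c * p (c *\<^sub>R x)"
      using scale[of "inverse c" "c *\<^sub>R x"] c by simp
    then have "c * p x \<le> p (c *\<^sub>R x)"
      using c by (simp add: field_simps)
    then show ?thesis
      using scale[OF c, of x] by simp
  qed (simp add: zero)
  then show ?thesis
    using add by (simp add: sublinear_def)
qed

text \<open>The largest sublinear functional \<open>q \<le> p\<close> with \<open>q (- x) = - p x\<close>.\<close>

definition sublinear_flatten :: "('a::real_vector \<Rightarrow> real) \<Rightarrow> 'a \<Rightarrow> 'a \<Rightarrow> real" where
  "sublinear_flatten p x y = (INF t\<in>{0..}. p (y + t *\<^sub>R x) - t * p x)"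

lemma sublinear_flatten_le:
  assumes "sublinear p" "0 \<le> t"
  shows "sublinear_flatten p x y \<le> p (y + t *\<^sub>R x) - t * p x"
  unfolding sublinear_flatten_def
proof (rule cINF_lower)
  \<comment> \<open>This bound is independent of \<open>s\<close>, so the infimum runs over a set
    that is bounded below.\<close>
  have "- p (- y) \<le> p (y + s *\<^sub>R x) - s * p x" if "s \<ge> 0" for s
    using sublinear_add[OF assms(1), of "- y" "y + s *\<^sub>R x"] sublinear_scaleR[OF assms(1) that, of x]
    by simp
  then show "bdd_below ((\<lambda>t. p (y + t *\<^sub>R x) - t * p x) ` {0..})"
    by (intro bdd_belowI2) auto
qed (use assms in simp)

lemma sublinear_flatten_greatest:
  assumes "\<And>t. 0 \<le> t \<Longrightarrow> b \<le> p (y + t *\<^sub>R x) - t * p x"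
  shows "b \<le> sublinear_flatten p x y"
  unfolding sublinear_flatten_def by (rule cINF_greatest) (use assms in auto)

lemma sublinear_flatten_le_self: "sublinear p \<Longrightarrow> sublinear_flatten p x y \<le> p y"
  using sublinear_flatten_le[of p 0 x y] by simp

lemma sublinear_flatten_neg: "sublinear p \<Longrightarrow> sublinear_flatten p x (- x) \<le> - p x"
  using sublinear_flatten_le[of p 1 x "- x"] by (simp add: sublinear_0)

text \<open>Parameters \<open>s\<close> for \<open>y\<close> and \<open>t\<close> for
  \<open>z\<close> combine to the parameter \<open>s + t\<close> for \<open>y + z\<close>; scaling
  by \<open>c\<close> turns \<open>t\<close> into \<open>c * t\<close>.\<close>

lemma sublinear_sublinear_flatten:
  assumes p: "sublinear p"
  shows "sublinear (sublinear_flatten p x)"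
proof (rule sublinearI)
  fix y z
  have *: "sublinear_flatten p x (y + z) \<le> (p (y + s *\<^sub>R x) - s * p x) + (p (z + t *\<^sub>R x) - t * p x)"
    if "0 \<le> s" "0 \<le> t" for s t
  proof -
    have "sublinear_flatten p x (y + z) \<le> p (y + z + (s + t) *\<^sub>R x) - (s + t) * p x"
      using that by (intro sublinear_flatten_le p) simp
    also have "y + z + (s + t) *\<^sub>R x = (y + s *\<^sub>R x) + (z + t *\<^sub>R x)"
      by (simp add: algebra_simps)
    finally show ?thesis
      using sublinear_add[OF p, of "y + s *\<^sub>R x" "z + t *\<^sub>R x"] by (simp add: algebra_simps)
  qed
  \<comment> \<open>The two infima are taken one after the other: first over \<open>t\<close> with
    \<open>s\<close> fixed, then over \<open>s\<close>.\<close>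
  have "sublinear_flatten p x (y + z) - (p (y + s *\<^sub>R x) - s * p x) \<le> sublinear_flatten p x z"
    if "0 \<le> s" for s
    by (rule sublinear_flatten_greatest) (use *[OF that] in \<open>simp add: algebra_simps\<close>)
  then have "sublinear_flatten p x (y + z) - sublinear_flatten p x z \<le> sublinear_flatten p x y"
    by (intro sublinear_flatten_greatest) (simp add: algebra_simps)
  then show "sublinear_flatten p x (y + z) \<le> sublinear_flatten p x y + sublinear_flatten p x z"
    by simp
next
  fix c :: real and y
  assume c: "0 < c"
  have "sublinear_flatten p x (c *\<^sub>R y) / c \<le> sublinear_flatten p x y"
  proof (rule sublinear_flatten_greatest)
    fix t :: real
    assume t: "0 \<le> t"
    have "sublinear_flatten p x (c *\<^sub>R y) \<le> p (c *\<^sub>R y + (c * t) *\<^sub>R x) - c * t * p x"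
      using c t by (intro sublinear_flatten_le p) simp
    also have "\<dots> = c * (p (y + t *\<^sub>R x) - t * p x)"
      using sublinear_scaleR[OF p, of c "y + t *\<^sub>R x"] c by (simp add: algebra_simps)
    finally show "sublinear_flatten p x (c *\<^sub>R y) / c \<le> p (y + t *\<^sub>R x) - t * p x"
      using c by (simp add: field_simps)
  qed
  then show "sublinear_flatten p x (c *\<^sub>R y) \<le> c * sublinear_flatten p x y"
    using c by (simp add: field_simps)
next
  have "0 \<le> sublinear_flatten p x 0"
    by (rule sublinear_flatten_greatest) (simp add: sublinear_scaleR[OF p])
  then show "sublinear_flatten p x 0 = 0"
    using sublinear_flatten_le_self[OF p, of x 0] by (simp add: sublinear_0[OF p])
qed

text \<open>The common majorant \<open>q\<close> bounds the chain from below by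
  \<open>- q (- x)\<close>, so the pointwise infimum is a genuine one. Subadditivity survives
  because the members are comparable.\<close>

lemma sublinear_Inf_chain:
  assumes "C \<noteq> {}" and sub: "\<And>p. p \<in> C \<Longrightarrow> sublinear p" and le: "\<And>p x. p \<in> C \<Longrightarrow> p x \<le> q x"
    and chain: "\<And>p p'. p \<in> C \<Longrightarrow> p' \<in> C \<Longrightarrow> p \<le> p' \<or> p' \<le> p"
  shows "sublinear (\<lambda>x. INF p\<in>C. p x)" and "\<And>p x. p \<in> C \<Longrightarrow> (INF p\<in>C. p x) \<le> p x"
proof -
  have "- q (- x) \<le> p x" if "p \<in> C" for p x
    using sublinear_minus_le[OF sub[OF that], of x] le[OF that, of "- x"] by linarith
  then have "bdd_below ((\<lambda>p. p x) ` C)" for x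
    by (intro bdd_belowI2)
  then show lower: "(INF p\<in>C. p x) \<le> p x" if "p \<in> C" for p x
    using that by (intro cINF_lower)
  note greatest = cINF_greatest[OF \<open>C \<noteq> {}\<close>]
  show "sublinear (\<lambda>x. INF p\<in>C. p x)"
  proof (rule sublinearI)
    fix x y
    have *: "(INF p\<in>C. p (x + y)) \<le> p x + p' y" if pp': "p \<in> C" "p' \<in> C" for p p'
    proof -
      \<comment> \<open>The smaller of \<open>p\<close> and \<open>p'\<close> serves both arguments
        at once.\<close>
      obtain r where r: "r \<in> C" "r \<le> p" "r \<le> p'"
        using chain[OF pp'] pp' by blast
      have "(INF p\<in>C. p (x + y)) \<le> r x + r y"
        using lower[OF r(1), of "x + y"] sublinear_add[OF sub[OF r(1)], of x y] by linarith
      then show ?thesis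
        using le_funD[OF r(2), of x] le_funD[OF r(3), of y] by linarith
    qed
    have "(INF p\<in>C. p (x + y)) - p x \<le> (INF p\<in>C. p y)" if "p \<in> C" for p
      by (rule greatest) (use *[OF that] in \<open>simp add: algebra_simps\<close>)
    then have "(INF p\<in>C. p (x + y)) - (INF p\<in>C. p y) \<le> (INF p\<in>C. p x)"
      by (intro greatest) (simp add: algebra_simps)
    then show "(INF p\<in>C. p (x + y)) \<le> (INF p\<in>C. p x) + (INF p\<in>C. p y)"
      by simp
  next
    fix c :: real and x
    assume c: "0 < c"
    have "(INF p\<in>C. p (c *\<^sub>R x)) / c \<le> (INF p\<in>C. p x)"
    proof (rule greatest)
      fix p
      assume p: "p \<in> C"
      show "(INF p\<in>C. p (c *\<^sub>R x)) / c \<le> p x"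
        using lower[OF p, of "c *\<^sub>R x"] sublinear_scaleR[OF sub[OF p], of c x] c
        by (simp add: field_simps)
    qed
    then show "(INF p\<in>C. p (c *\<^sub>R x)) \<le> c * (INF p\<in>C. p x)"
      using c by (simp add: field_simps)
  next
    have "(\<lambda>p. p 0) ` C = {0}"
      using \<open>C \<noteq> {}\<close> sub by (auto simp: sublinear_0 image_iff)
    then show "(INF p\<in>C. p 0) = 0"
      by simp
  qed
qed

text \<open>A minimal sublinear functional is linear, since it agrees with its flattening along every
  line.\<close>

lemma sublinear_dominates_linear:
  assumes q: "sublinear q"
  obtains f where "linear f" "\<And>x. f x \<le> q x"
proof -
  define A where "A = {p. sublinear p \<and> p \<le> q}"
  \<comment> \<open>The order is reversed: Zorn's lemma provides maximal elements, and a minimal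
    functional is wanted.\<close>
  define R where "R = relation_of (\<lambda>p p' :: 'a \<Rightarrow> real. p' \<le> p) A"
  have "partial_order_on A R"
    unfolding R_def by (rule partial_order_on_relation_ofI) auto
  moreover have "\<exists>u\<in>A. \<forall>p\<in>C. u \<le> p" if C: "C \<in> Chains R" for C
  proof (cases "C = {}")
    case False
    have chain: "p \<le> p' \<or> p' \<le> p" if "p \<in> C" "p' \<in> C" for p p'
      using C that by (auto simp: Chains_def R_def relation_of_def)
    have CA: "C \<subseteq> A"
      using C by (auto simp: Chains_def R_def relation_of_def)
    have sub: "sublinear p" and le: "p x \<le> q x" if "p \<in> C" for p x
      using CA that by (auto simp: A_def le_fun_def)
    have inf: "sublinear (\<lambda>x. INF p\<in>C. p x)" "\<And>p x. p \<in> C \<Longrightarrow> (INF p\<in>C. p x) \<le> p x"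
      using sublinear_Inf_chain[of C q] False sub le chain by blast+
    obtain p where "p \<in> C" using False by blast
    then have "(INF p\<in>C. p x) \<le> q x" for x
      using inf(2)[OF \<open>p \<in> C\<close>, of x] le[of p x] by (meson order_trans)
    then show ?thesis
      using inf by (intro bexI[of _ "\<lambda>x. INF p\<in>C. p x"]) (auto simp: A_def le_fun_def)
  \<comment> \<open>The empty chain is bounded by \<open>q\<close> itself.\<close>
  qed (use q in \<open>auto simp: A_def\<close>)
  ultimately obtain f where "f \<in> A" and min: "\<And>p. p \<in> A \<Longrightarrow> p \<le> f \<Longrightarrow> p = f"
    using predicate_Zorn[of A "\<lambda>p p'. p' \<le> p"] unfolding R_def by blast
  then have f: "sublinear f" and fq: "f \<le> q"
    by (auto simp: A_def)
  have neg: "f (- x) = - f x" for x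
  proof -
    have le: "sublinear_flatten f x \<le> f"
      by (simp add: le_funI sublinear_flatten_le_self[OF f])
    have "sublinear_flatten f x = f"
      by (rule min[OF _ le])
        (use le fq in \<open>auto simp: A_def sublinear_sublinear_flatten[OF f] intro: order_trans\<close>)
    \<comment> \<open>Flattening gives \<open>f (- x) \<le> - f x\<close>, and subadditivity at
      \<open>x\<close> and \<open>- x\<close> gives the converse.\<close>
    then show ?thesis
      using sublinear_flatten_neg[OF f, of x] sublinear_minus_le[OF f, of x] by simp
  qed
  have "linear f"
  proof (rule linearI)
    fix x y
    \<comment> \<open>The reverse inequality is subadditivity at \<open>- x\<close> and
      \<open>- y\<close>, carried over by oddness.\<close>
    show "f (x + y) = f x + f y"
      using sublinear_add[OF f, of x y] sublinear_add[OF f, of "- x" "- y"] neg[of "x + y"]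
      by (simp add: neg)
  next
    fix c :: real and x
    show "f (c *\<^sub>R x) = c *\<^sub>R f x"
    proof (cases "0 \<le> c")
      case False
      then show ?thesis
        using sublinear_scaleR[OF f, of "- c" x] neg[of "c *\<^sub>R x"] by simp
    qed (simp add: sublinear_scaleR[OF f])
  qed
  then show thesis
    using that fq by (auto simp: le_fun_def)
qed

text \<open>A linear functional below the norm flattened along \<open>x\<close> satisfies
  \<open>f (- x) \<le> - norm x\<close>, hence \<open>f x \<ge> norm x > 0\<close>. This replaces
  the extension of a functional from the line through \<open>x\<close>.\<close>

lemma dual_separates_point:
  fixes x :: "'a::real_normed_vector"
  assumes "x \<noteq> 0"
  obtains \<phi> :: "'a \<Rightarrow>\<^sub>L real" where "blinfun_apply \<phi> x \<noteq> 0"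
proof -
  have norm: "sublinear (norm :: 'a \<Rightarrow> real)"
    by (simp add: sublinear_def norm_triangle_ineq)
  obtain f where f: "linear f" and le: "\<And>y. f y \<le> sublinear_flatten norm x y"
    using sublinear_dominates_linear[OF sublinear_sublinear_flatten[OF norm]] by blast
  have le_norm: "f y \<le> norm y" for y
    using le[of y] sublinear_flatten_le_self[OF norm, of x y] by linarith
  have "\<bar>f y\<bar> \<le> norm y" for y
    using le_norm[of y] le_norm[of "- y"] by (simp add: linear_neg[OF f] abs_le_iff)
  then have "bounded_linear f"
    using f by (intro bounded_linear_intro[of f 1]) (auto simp: linear_add linear_scale)
  moreover have "f x \<noteq> 0"
    using le[of "- x"] sublinear_flatten_neg[OF norm, of x] assms zero_less_norm_iff[of x]
    by (simp add: linear_neg[OF f] del: zero_less_norm_iff)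
  ultimately show thesis
    using that[of "Blinfun f"] by (simp add: bounded_linear_Blinfun_apply)
qed

section \<open>Precomposition with maps between duals\<close>

lemma norm_eval_h0_le: "norm (eval_h0 x) \<le> norm x"
proof (cases "x = 0")
  case True
  then show ?thesis
    by (intro norm_h0_leI) (simp_all add: eval_h0.rep_eq blinfun.zero_right)
next
  case False
  show ?thesis
  proof (rule norm_h0_leI)
    fix \<phi>s :: "('a \<Rightarrow>\<^sub>L real) list"
    assume "\<phi>s \<in> admissible"
    then have "(\<Sum>\<phi>\<leftarrow>\<phi>s. \<bar>blinfun_apply \<phi> (inverse (norm x) *\<^sub>R x)\<bar>) \<le> 1"
      using False by (simp add: admissible_iff)
    then have "inverse (norm x) * (\<Sum>\<phi>\<leftarrow>\<phi>s. \<bar>blinfun_apply \<phi> x\<bar>) \<le> 1"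
      by (simp add: blinfun.scaleR_right abs_mult sum_list_const_mult del: inverse_eq_divide)
    then show "(\<Sum>\<phi>\<leftarrow>\<phi>s. \<bar>h0_apply (eval_h0 x) \<phi>\<bar>) \<le> norm x"
      using False by (simp add: field_simps eval_h0.rep_eq)
  qed simp
qed

text \<open>Linearity would be too strong a demand: \<open>fbl_eval\<close> is in general not
  additive. Positive homogeneity keeps precomposition within the positively homogeneous functions,
  and preserving admissible families makes it contractive.\<close>

definition dual_morphism :: "(('b::banach \<Rightarrow>\<^sub>L real) \<Rightarrow> ('a::banach \<Rightarrow>\<^sub>L real)) \<Rightarrow> bool" where
  "dual_morphism \<iota> \<longleftrightarrow> (\<forall>c>0. \<forall>\<phi>. \<iota> (c *\<^sub>R \<phi>) = c *\<^sub>R \<iota> \<phi>) \<and>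
     (\<forall>\<phi>s\<in>admissible. map \<iota> \<phi>s \<in> admissible)"

definition h0_precomp ::
    "(('b::banach \<Rightarrow>\<^sub>L real) \<Rightarrow> ('a::banach \<Rightarrow>\<^sub>L real)) \<Rightarrow> 'a h0 \<Rightarrow> 'b h0" where
  "h0_precomp \<iota> f = Abs_h0 (\<lambda>\<phi>. h0_apply f (\<iota> \<phi>))"

text \<open>\<open>Abs_fbl\<close> is meaningful here once \<open>h0_precomp \<iota>\<close> maps
  \<open>fbl_set\<close> into \<open>fbl_set\<close>, which is verified on the evaluations.\<close>

definition fbl_precomp ::
    "(('b::banach \<Rightarrow>\<^sub>L real) \<Rightarrow> ('a::banach \<Rightarrow>\<^sub>L real)) \<Rightarrow> 'a fbl \<Rightarrow> 'b fbl" where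
  "fbl_precomp \<iota> f = Abs_fbl (h0_precomp \<iota> (h0_of_fbl f))"

text \<open>The image family is admissible, so its sum is among those whose supremum is
  \<open>norm f\<close>.\<close>

lemma sum_list_precomp_le:
  assumes "dual_morphism \<iota>" "\<phi>s \<in> admissible"
  shows "(\<Sum>\<phi>\<leftarrow>\<phi>s. \<bar>h0_apply f (\<iota> \<phi>)\<bar>) \<le> norm f"
  using sum_list_le_norm_h0[of "map \<iota> \<phi>s" f] assms by (simp add: dual_morphism_def o_def)

lemma h0_apply_precomp:
  assumes "dual_morphism \<iota>"
  shows "h0_apply (h0_precomp \<iota> f) \<phi> = h0_apply f (\<iota> \<phi>)"
proof -
  have "fbl_norm (\<lambda>\<phi>. h0_apply f (\<iota> \<phi>)) < \<infinity>"
    by (rule fbl_norm_finiteI[of "norm f"]) (simp_all add: sum_list_precomp_le[OF assms])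
  moreover have "pos_homogeneous (\<lambda>\<phi>. h0_apply f (\<iota> \<phi>))"
    using assms by (simp add: pos_homogeneous_def dual_morphism_def h0_apply_scaleR)
  ultimately show ?thesis
    by (simp add: h0_precomp_def Abs_h0_inverse)
qed

lemma norm_h0_precomp_le:
  assumes "dual_morphism \<iota>"
  shows "norm (h0_precomp \<iota> f) \<le> norm f"
  by (rule norm_h0_leI) (simp_all add: h0_apply_precomp sum_list_precomp_le assms)

lemma h0_precomp_lattice_ops:
  assumes "dual_morphism \<iota>"
  shows "h0_precomp \<iota> (f + g) = h0_precomp \<iota> f + h0_precomp \<iota> g"
    and "h0_precomp \<iota> (c *\<^sub>R f) = c *\<^sub>R h0_precomp \<iota> f"
    and "h0_precomp \<iota> (sup f g) = sup (h0_precomp \<iota> f) (h0_precomp \<iota> g)"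
    and "h0_precomp \<iota> (inf f g) = inf (h0_precomp \<iota> f) (h0_precomp \<iota> g)"
  by (simp_all add: h0_apply_inject[symmetric] fun_eq_iff h0_apply_precomp assms
      plus_h0.rep_eq scaleR_h0.rep_eq sup_h0.rep_eq inf_h0.rep_eq)

lemma bounded_linear_h0_precomp:
  assumes "dual_morphism \<iota>"
  shows "bounded_linear (h0_precomp \<iota>)"
  by (rule bounded_linear_intro[of _ 1])
    (simp_all add: h0_precomp_lattice_ops norm_h0_precomp_le assms)

text \<open>The preimage of \<open>fbl_set\<close> under a continuous lattice homomorphism is a
  closed sublattice; containing the generators, it contains their hull.\<close>

lemma h0_precomp_in_fbl_set:
  assumes \<iota>: "dual_morphism \<iota>" and gen: "\<And>x. h0_precomp \<iota> (eval_h0 x) \<in> fbl_set"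
    and f: "f \<in> fbl_set"
  shows "h0_precomp \<iota> f \<in> fbl_set"
proof -
  interpret bounded_linear "h0_precomp \<iota>"
    by (rule bounded_linear_h0_precomp[OF \<iota>])
  have "closed_sublattice (h0_precomp \<iota> -` fbl_set)"
    unfolding closed_sublattice_def
    by (intro conjI ballI closed_vimage closed_fbl_set continuous_on continuous_on_id
        linear_subspace_vimage linear_axioms subspace_fbl_set)
      (simp_all add: h0_precomp_lattice_ops \<iota> sup_fbl_set inf_fbl_set)
  moreover have "range eval_h0 \<subseteq> h0_precomp \<iota> -` fbl_set"
    using gen by auto
  ultimately have "fbl_set \<subseteq> h0_precomp \<iota> -` fbl_set"
    unfolding fbl_set_def by (intro hull_minimal) (simp_all add: fbl_set_def)
  then show ?thesis
    using f by auto
qed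

lemma h0_of_fbl_precomp:
  assumes "dual_morphism \<iota>" "\<And>x. h0_precomp \<iota> (eval_h0 x) \<in> fbl_set"
  shows "h0_of_fbl (fbl_precomp \<iota> f) = h0_precomp \<iota> (h0_of_fbl f)"
  by (simp add: fbl_precomp_def Abs_fbl_inverse h0_precomp_in_fbl_set[OF assms] h0_of_fbl)

lemma norm_fbl_precomp_le:
  assumes "dual_morphism \<iota>" "\<And>x. h0_precomp \<iota> (eval_h0 x) \<in> fbl_set"
  shows "norm (fbl_precomp \<iota> f) \<le> norm f"
  by (simp add: norm_fbl.rep_eq h0_of_fbl_precomp[OF assms] norm_h0_precomp_le[OF assms(1)])

lemma lattice_hom_fbl_precomp:
  assumes "dual_morphism \<iota>" "\<And>x. h0_precomp \<iota> (eval_h0 x) \<in> fbl_set"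
  shows "lattice_hom (fbl_precomp \<iota>)"
  unfolding lattice_hom_def
proof (intro conjI allI)
  show "bounded_linear (fbl_precomp \<iota>)"
    by (rule bounded_linear_intro[of _ 1])
      (simp_all add: norm_fbl_precomp_le[OF assms] h0_of_fbl_inject[symmetric] plus_fbl.rep_eq
        scaleR_fbl.rep_eq h0_of_fbl_precomp[OF assms] h0_precomp_lattice_ops[OF assms(1)])
qed (simp_all add: h0_of_fbl_inject[symmetric] sup_fbl.rep_eq inf_fbl.rep_eq
    h0_of_fbl_precomp[OF assms] h0_precomp_lattice_ops[OF assms(1)])

section \<open>Generators\<close>

text \<open>Induction principle for the type \<open>fbl\<close>: the image of \<open>S\<close> in
  \<open>h0\<close> is again a closed sublattice, so minimality of the hull applies there.\<close>

lemma fbl_induct_generators: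
  assumes S: "closed_sublattice S" and gen: "\<And>x. delta x \<in> S"
  shows "f \<in> S"
proof -
  have closed: "closed (h0_of_fbl ` S)"
    unfolding closed_sequential_limits
  proof (intro allI impI, elim conjE)
    fix X l
    assume X: "\<forall>n. X n \<in> h0_of_fbl ` S" and l: "X \<longlonglongrightarrow> l"
    then obtain Y where Y: "\<And>n. Y n \<in> S" "\<And>n. X n = h0_of_fbl (Y n)"
      unfolding image_iff by metis
    have "l \<in> fbl_set"
      by (rule closed_sequentially[OF closed_fbl_set _ l]) (simp add: Y h0_of_fbl)
    then have l_eq: "h0_of_fbl (Abs_fbl l) = l"
      by (rule Abs_fbl_inverse)
    \<comment> \<open>The embedding into \<open>h0\<close> is isometric, so the convergence can be
      pulled back.\<close>
    have "dist (Y n) (Abs_fbl l) = dist (X n) l" for n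
      by (simp add: dist_norm norm_fbl.rep_eq minus_fbl.rep_eq l_eq Y)
    then have "Y \<longlonglongrightarrow> Abs_fbl l"
      using l by (simp add: tendsto_dist_iff[of Y] tendsto_dist_iff[of X])
    then have "Abs_fbl l \<in> S"
      using S Y(1) by (elim closed_sequentially[rotated -1]) (simp_all add: closed_sublattice_def)
    then show "l \<in> h0_of_fbl ` S"
      using imageI[of "Abs_fbl l" S h0_of_fbl] by (simp add: l_eq)
  qed
  have "closed_sublattice (h0_of_fbl ` S)"
    unfolding closed_sublattice_def
  proof (intro conjI closed ballI)
    have "linear (h0_of_fbl :: 'a fbl \<Rightarrow> 'a h0)"
      by (rule linearI) (simp_all add: plus_fbl.rep_eq scaleR_fbl.rep_eq)
    then show "subspace (h0_of_fbl ` S)"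
      using S by (intro linear_subspace_image) (simp_all add: closed_sublattice_def)
  next
    fix u v
    assume "u \<in> h0_of_fbl ` S" "v \<in> h0_of_fbl ` S"
    then obtain f g where fg: "f \<in> S" "g \<in> S" "u = h0_of_fbl f" "v = h0_of_fbl g"
      by blast
    then have "sup f g \<in> S" "inf f g \<in> S"
      using S by (auto simp: closed_sublattice_def)
    then show "sup u v \<in> h0_of_fbl ` S" "inf u v \<in> h0_of_fbl ` S"
      unfolding fg sup_fbl.rep_eq[symmetric] inf_fbl.rep_eq[symmetric] by simp_all
  qed
  moreover have "range eval_h0 \<subseteq> h0_of_fbl ` S"
    using gen by (auto simp flip: delta.rep_eq)
  ultimately have "fbl_set \<subseteq> h0_of_fbl ` S"
    unfolding fbl_set_def by (intro hull_minimal)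
  then show ?thesis
    using h0_of_fbl[of f] by (auto simp: h0_of_fbl_inject)
qed

text \<open>The set where two lattice homomorphisms agree is a closed sublattice.\<close>

lemma lattice_hom_eq_on_generators:
  assumes S: "lattice_hom S" and T: "lattice_hom T" and eq: "\<And>x. S (delta x) = T (delta x)"
  shows "S = T"
proof
  fix f
  interpret S: bounded_linear S using S by (simp add: lattice_hom_def)
  interpret T: bounded_linear T using T by (simp add: lattice_hom_def)
  have "closed_sublattice {f. S f = T f}"
    using S T unfolding closed_sublattice_def lattice_hom_def
    by (auto simp: subspace_def S.zero T.zero S.add T.add S.scaleR T.scaleR
        intro!: closed_Collect_eq S.continuous_on T.continuous_on continuous_on_id)
  then have "f \<in> {f. S f = T f}"
    by (rule fbl_induct_generators) (simp add: eq)
  then show "S f = T f"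
    by simp
qed

text \<open>Resolves the definite description: exhibiting one suitable \<open>S\<close> settles
  existence, and agreement on generators settles uniqueness.\<close>

lemma beta_unique:
  assumes "lattice_hom S" "\<And>x. S (delta x) = x"
  shows "beta = S"
  unfolding beta_def
proof (rule the_equality)
  show "lattice_hom S \<and> S \<circ> delta = id"
    using assms by auto
  show "S' = S" if "lattice_hom S' \<and> S' \<circ> delta = id" for S'
    using that assms by (intro lattice_hom_eq_on_generators) (auto simp: fun_eq_iff)
qed

section \<open>Point evaluations and the adjoint of the embedding\<close>

definition fbl_eval :: "('a::banach \<Rightarrow>\<^sub>L real) \<Rightarrow> ('a fbl \<Rightarrow>\<^sub>L real)" where
  "fbl_eval \<phi> = Blinfun (\<lambda>f. h0_apply (h0_of_fbl f) \<phi>)"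

lemma fbl_eval_apply: "blinfun_apply (fbl_eval \<phi>) f = h0_apply (h0_of_fbl f) \<phi>"
proof -
  have "bounded_linear (\<lambda>f. h0_apply (h0_of_fbl f) \<phi>)"
    \<comment> \<open>The constant comes from testing the norm of \<open>f\<close> on the single
      functional \<open>\<phi>\<close>, normalised.\<close>
    by (rule bounded_linear_intro[of _ "norm \<phi>"])
      (use abs_h0_apply_le in \<open>simp_all add: plus_fbl.rep_eq plus_h0.rep_eq scaleR_fbl.rep_eq
        scaleR_h0.rep_eq norm_fbl.rep_eq\<close>)
  then show ?thesis
    by (simp add: fbl_eval_def bounded_linear_Blinfun_apply)
qed

lemma dual_morphism_fbl_eval: "dual_morphism fbl_eval"
  unfolding dual_morphism_def
proof (intro conjI allI impI ballI)
  fix \<phi>s :: "('a \<Rightarrow>\<^sub>L real) list"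
  assume adm: "\<phi>s \<in> admissible"
  show "map fbl_eval \<phi>s \<in> admissible"
    unfolding admissible_iff
  proof (intro allI impI)
    fix f :: "'a fbl"
    assume "norm f \<le> 1"
    then show "(\<Sum>\<psi>\<leftarrow>map fbl_eval \<phi>s. \<bar>blinfun_apply \<psi> f\<bar>) \<le> 1"
      using sum_list_le_norm_h0[OF adm, of "h0_of_fbl f"]
      by (simp add: o_def fbl_eval_apply norm_fbl.rep_eq)
  qed
qed (auto intro!: blinfun_eqI simp: fbl_eval_apply h0_apply_scaleR blinfun.scaleR_left)

text \<open>Evaluating \<open>f\<close> at \<open>\<phi>\<close> is the same as applying the
  functional \<open>fbl_eval \<phi>\<close> to \<open>f\<close>; hence precomposition undoes
  \<open>delta\<close> on \<open>fbl\<close>.\<close>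

lemma fbl_eval_precomp_eval: "h0_precomp fbl_eval (eval_h0 f) = h0_of_fbl f"
  by (simp add: h0_apply_inject[symmetric] fun_eq_iff h0_apply_precomp dual_morphism_fbl_eval
      eval_h0.rep_eq fbl_eval_apply)

definition delta_adjoint :: "('a::banach fbl \<Rightarrow>\<^sub>L real) \<Rightarrow> ('a \<Rightarrow>\<^sub>L real)" where
  "delta_adjoint \<Phi> = Blinfun (\<lambda>x. blinfun_apply \<Phi> (delta x))"

lemma norm_delta_le: "norm (delta x) \<le> norm x"
  by (simp add: norm_fbl.rep_eq delta.rep_eq norm_eval_h0_le)

lemma delta_adjoint_apply: "blinfun_apply (delta_adjoint \<Phi>) x = blinfun_apply \<Phi> (delta x)"
proof -
  have "bounded_linear delta"
    by (rule bounded_linear_intro[of _ 1])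
      (simp_all add: norm_delta_le h0_of_fbl_inject[symmetric] h0_apply_inject[symmetric] fun_eq_iff
        delta.rep_eq eval_h0.rep_eq plus_fbl.rep_eq plus_h0.rep_eq scaleR_fbl.rep_eq
        scaleR_h0.rep_eq blinfun.add_right blinfun.scaleR_right)
  then have "bounded_linear (\<lambda>x. blinfun_apply \<Phi> (delta x))"
    by (rule bounded_linear_compose[OF blinfun.bounded_linear_right])
  then show ?thesis
    by (simp add: delta_adjoint_def bounded_linear_Blinfun_apply)
qed

text \<open>Admissibility passes through the adjoint because \<open>delta\<close> maps the unit ball
  into the unit ball.\<close>

lemma dual_morphism_delta_adjoint: "dual_morphism delta_adjoint"
  unfolding dual_morphism_def
proof (intro conjI allI impI ballI)
  fix \<Phi>s :: "('a fbl \<Rightarrow>\<^sub>L real) list"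
  assume adm: "\<Phi>s \<in> admissible"
  show "map delta_adjoint \<Phi>s \<in> admissible"
    unfolding admissible_iff
  proof (intro allI impI)
    fix x :: 'a
    assume "norm x \<le> 1"
    then have "norm (delta x) \<le> 1"
      using norm_delta_le[of x] by linarith
    then show "(\<Sum>\<phi>\<leftarrow>map delta_adjoint \<Phi>s. \<bar>blinfun_apply \<phi> x\<bar>) \<le> 1"
      using adm by (simp add: admissible_iff o_def delta_adjoint_apply)
  qed
qed (auto intro!: blinfun_eqI simp: delta_adjoint_apply blinfun.scaleR_left)

lemma delta_adjoint_precomp_eval: "h0_precomp delta_adjoint (eval_h0 x) = eval_h0 (delta x)"
  by (simp add: h0_apply_inject[symmetric] fun_eq_iff h0_apply_precomp dual_morphism_delta_adjoint
      eval_h0.rep_eq delta_adjoint_apply)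

theorem proposition2p3:
  assumes nontrivial: "\<exists>x :: 'a::banach. x \<noteq> 0"
  shows "isometric_lattice_lifting_property TYPE('a fbl)"
proof -
  define B :: "'a fbl fbl \<Rightarrow> 'a fbl" where "B = fbl_precomp fbl_eval"
  define T :: "'a fbl \<Rightarrow> 'a fbl fbl" where "T = fbl_precomp delta_adjoint"
  have B_in: "h0_precomp fbl_eval (eval_h0 f) \<in> fbl_set" for f :: "'a fbl"
    by (simp add: fbl_eval_precomp_eval h0_of_fbl)
  have T_in: "h0_precomp delta_adjoint (eval_h0 x) \<in> fbl_set" for x :: 'a
    by (simp add: delta_adjoint_precomp_eval eval_h0_in_fbl_set)
  note precomp_B = dual_morphism_fbl_eval B_in
  note precomp_T = dual_morphism_delta_adjoint T_in
  have B: "lattice_hom B" and T: "lattice_hom T"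
    unfolding B_def T_def
    by (rule lattice_hom_fbl_precomp[OF precomp_B] lattice_hom_fbl_precomp[OF precomp_T])+
  have B_delta: "B (delta f) = f" for f
    by (simp add: B_def h0_of_fbl_inject[symmetric] h0_of_fbl_precomp[OF precomp_B] delta.rep_eq
        fbl_eval_precomp_eval)
  have T_delta: "T (delta x) = delta (delta x)" for x
    by (simp add: T_def h0_of_fbl_inject[symmetric] h0_of_fbl_precomp[OF precomp_T] delta.rep_eq
        delta_adjoint_precomp_eval)
  have "lattice_hom (B \<circ> T)"
    using B T unfolding lattice_hom_def by (auto intro: bounded_linear_compose simp: comp_def)
  moreover have "lattice_hom (id :: 'a fbl \<Rightarrow> 'a fbl)"
    by (simp add: lattice_hom_def id_def bounded_linear_ident)
  ultimately have BT: "B \<circ> T = id"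
    by (rule lattice_hom_eq_on_generators) (simp add: T_delta B_delta)
  have norm_B: "norm (B g) \<le> norm g" for g
    unfolding B_def by (rule norm_fbl_precomp_le[OF precomp_B])
  have norm_T: "norm (T f) = norm f" for f
  proof (rule antisym)
    show "norm (T f) \<le> norm f"
      unfolding T_def by (rule norm_fbl_precomp_le[OF precomp_T])
    \<comment> \<open>Here \<open>f = B (T f)\<close> and \<open>B\<close> is contractive.\<close>
    show "norm f \<le> norm (T f)"
      using norm_B[of "T f"] fun_cong[OF BT, of f] by simp
  qed
  \<comment> \<open>On a zero space \<open>onorm T\<close> would be 0, so a nonzero element of
    \<open>fbl\<close> is exhibited, namely \<open>delta x\<close>.\<close>
  obtain x :: 'a where "x \<noteq> 0"
    using nontrivial by blast
  then obtain \<phi> :: "'a \<Rightarrow>\<^sub>L real" where "blinfun_apply \<phi> x \<noteq> 0"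
    by (rule dual_separates_point)
  then have "delta x \<noteq> 0"
    by (metis delta.rep_eq eval_h0.rep_eq zero_fbl.rep_eq zero_h0.rep_eq)
  have "onorm T = 1"
  proof (rule antisym)
    show "onorm T \<le> 1"
      by (rule onorm_bound) (simp_all add: norm_T)
    \<comment> \<open>The left side equals \<open>norm (delta x)\<close>, which is positive and
      cancels.\<close>
    have "norm (T (delta x)) \<le> onorm T * norm (delta x)"
      using T by (intro onorm) (simp add: lattice_hom_def)
    then show "1 \<le> onorm T"
      using \<open>delta x \<noteq> 0\<close> by (simp add: norm_T)
  qed
  moreover have "beta = B"
    by (rule beta_unique[OF B B_delta])
  ultimately show ?thesis
    unfolding isometric_lattice_lifting_property_def using T BT by auto
qed

end
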